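(* Let $n\ge 1$, let $\lVert\cdot\rVert$ be any monotonic norm on $\mathbb{R}^n$, and define $\mathcal{F}_s(\mathbf{x},\mathbf{y})=\lVert \mathrm{ReLU}(\mathbf{x}-\mathbf{y})\rVert$ for $\mathbf{x},\mathbf{y}\in\mathbb{R}^n$. Let $G\mapsto\mathbf{Z}_G\in\mathbb{R}^n$ be a map assigning to each graph an embedding vector. Then for all graphs $G_Q,G_T,G_{T'}$, $$\mathcal{F}_s(\mathbf{Z}_{G_Q},\mathbf{Z}_{G_T})\le \mathcal{F}_s(\mathbf{Z}_{G_Q},\mathbf{Z}_{G_{T'}})+\mathcal{F}_s(\mathbf{Z}_{G_{T'}},\mathbf{Z}_{G_T}).$$
   Context: $\mathrm{ReLU}(\mathbf{x})$ is the vector with coordinates $\max\{0,\mathbf{x}[i]\}$. A norm on $\mathbb{R}^n$ is monotonic if $|\mathbf{x}[i]|\le|\mathbf{y}[i]|$ for all coordinates $i$ implies $\lVert\mathbf{x}\rVert\le\lVert\mathbf{y}\rVert$. In the paper the embedding map is computed by a graph neural network; the statement concerns only the resulting vectors in $\mathbb{R}^n$, regardless of which embedding map is used. *)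

theory Defs
  imports "HOL-Analysis.Analysis"
begin

(* The library's norm is a fixed type-class operation (on real ^ 'n, the Euclidean norm), so an
   arbitrary norm on the space is a function N satisfying the norm axioms. *)
definition is_norm :: "('a::real_vector \<Rightarrow> real) \<Rightarrow> bool" where
  "is_norm N \<longleftrightarrow>
     (\<forall>x. 0 \<le> N x) \<and>
     (\<forall>x. N x = 0 \<longleftrightarrow> x = 0) \<and>
     (\<forall>c x. N (c *\<^sub>R x) = \<bar>c\<bar> * N x) \<and>
     (\<forall>x y. N (x + y) \<le> N x + N y)"

definition monotonic :: "(real ^ 'n \<Rightarrow> real) \<Rightarrow> bool" where
  "monotonic N \<longleftrightarrow> (\<forall>x y. (\<forall>i. \<bar>x $ i\<bar> \<le> \<bar>y $ i\<bar>) \<longrightarrow> N x \<le> N y)"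

definition ReLU :: "real ^ 'n \<Rightarrow> real ^ 'n" where
  "ReLU x = (\<chi> i. max 0 (x $ i))"

definition F_s :: "(real ^ 'n \<Rightarrow> real) \<Rightarrow> real ^ 'n \<Rightarrow> real ^ 'n \<Rightarrow> real" where
  "F_s N x y = N (ReLU (x - y))"

end

theory Submission
  imports Defs
begin

text \<open>The scalar map t -> max 0 t is nonnegative and subadditive, so \<open>ReLU\<close> is
  subadditive in each coordinate, also between absolute values, as \<open>monotonic\<close> needs.
  Monotonicity lifts this to \<open>N\<close>, whose triangle inequality then splits the sum
  (\<open>F_s_triangle\<close>).\<close>

lemma abs_ReLU_add_le: "\<bar>ReLU (x + y) $ i\<bar> \<le> \<bar>(ReLU x + ReLU y) $ i\<bar>"
  by (simp add: ReLU_def)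

lemma F_s_triangle:
  assumes "is_norm N" and "monotonic N"
  shows "F_s N x z \<le> F_s N x y + F_s N y z"
proof -
  have "N (ReLU (x - z)) \<le> N (ReLU (x - y) + ReLU (y - z))"
    \<comment> \<open>The intermediate point cancels: \<open>(x - y) + (y - z)\<close> simplifies to
      \<open>x - z\<close>.\<close>
    using assms(2) abs_ReLU_add_le[of "x - y" "y - z"] by (simp add: monotonic_def)
  also have "\<dots> \<le> N (ReLU (x - y)) + N (ReLU (y - z))"
    using assms(1) by (simp add: is_norm_def)
  finally show ?thesis
    by (simp add: F_s_def)
qed

theorem lemma2:
  fixes N :: "real ^ 'n \<Rightarrow> real"
    and Z :: "'graph \<Rightarrow> real ^ 'n"
    and G_Q G_T G_T' :: 'graph
  assumes "is_norm N" and "monotonic N"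
  shows "F_s N (Z G_Q) (Z G_T) \<le> F_s N (Z G_Q) (Z G_T') + F_s N (Z G_T') (Z G_T)"
  using assms by (rule F_s_triangle)

end
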